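(* Let $\sigma>0$ and $\mathfrak{N}_\sigma=\{\mathcal{N}(\mu,\sigma^2):\mu\in\mathbb{R}\}$. Let $D$ be a dataset of $n$ users whose values are i.i.d. $\mathcal{N}(\mu,\sigma^2)$, and let $\boldsymbol{\varepsilon}_D=(\varepsilon_{D,1}\le\dots\le\varepsilon_{D,n})$ be the sorted vector of the budgets $\mathcal{E}(u)$, $u\in D$. Then \[ \inf_{\mathcal{M}}\sup_{\mathcal{N}(\mu,\sigma^2)\in\mathfrak{N}_\sigma}\Pr\left(|\mathcal{M}(D)-\mu|\ge\max_{k=1,\dots,n}\frac1{\sqrt2}\frac{\sigma}{\sum_{i=1}^k\varepsilon_{D,i}+2\sqrt{n-k}}\right)\ge\frac14, \] where the infimum ranges over all $\mathcal{E}$-PDP mechanisms $\mathcal{M}$ (unbounded setting).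
   Context: Unbounded PDP: there is a user universe $\mathcal{U}$, each user $u$ carrying a value $u.x\in\mathbb{R}$, and a public privacy function $\mathcal{E}:\mathcal{U}\to[\varepsilon_{\min},\varepsilon_{\max}]$. A dataset is a finite set of users. $D\sim_uD'$ if one is obtained from the other by deleting user $u$. A mechanism $\mathcal{M}$ satisfies $\mathcal{E}$-PDP if for all $u$, all $D\sim_uD'$ (in either direction) and all measurable $K$, $\Pr(\mathcal{M}(D)\in K)\le e^{\mathcal{E}(u)}\Pr(\mathcal{M}(D')\in K)$. *)

theory Defs
  imports "HOL-Probability.Probability"
begin

text \<open>
  The user universe is the type \<open>'u\<close>. Since the value carried by a user is random whereas the
  privacy function is public, a dataset records each participating user together with the value
  it carries: it is a finite set of pairs \<open>(u, x)\<close> in which no user occurs twice.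
\<close>

type_synonym 'u dataset = "('u \<times> real) set"

definition datasets :: "'u dataset set" where
  "datasets = {D. finite D \<and> inj_on fst D}"

definition with_values :: "'u set \<Rightarrow> ('u \<Rightarrow> real) \<Rightarrow> 'u dataset" where
  "with_values U x = (\<lambda>u. (u, x u)) ` U"

definition deletion :: "'u \<Rightarrow> 'u dataset \<Rightarrow> 'u dataset \<Rightarrow> bool" where
  "deletion u D D' \<longleftrightarrow> u \<in> fst ` D \<and> D' = {r \<in> D. fst r \<noteq> u}"

definition neighbours :: "'u \<Rightarrow> 'u dataset \<Rightarrow> 'u dataset \<Rightarrow> bool" where
  "neighbours u D D' \<longleftrightarrow>
     D \<in> datasets \<and> D' \<in> datasets \<and> (deletion u D D' \<or> deletion u D' D)"

text \<open>
  A mechanism with real output is a Markov kernel: \<open>M D\<close> is the law of the output on \<open>D\<close>. The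
  datasets with participating users \<open>U\<close> are identified with the product space of \<open>U\<close> copies of
  the real line, and the kernel is measurable on each of these. As every dataset has the form
  \<open>with_values U x\<close>, \<open>M D\<close> is a Borel probability measure for each dataset; the
  values of \<open>M\<close> on sets that are not datasets are irrelevant.
\<close>

definition mechanism :: "('u dataset \<Rightarrow> real measure) \<Rightarrow> bool" where
  "mechanism M \<longleftrightarrow>
     (\<forall>U. finite U \<longrightarrow>
        (\<lambda>x. M (with_values U x)) \<in> measurable (PiM U (\<lambda>_. borel)) (prob_algebra borel))"

definition pdp :: "('u \<Rightarrow> real) \<Rightarrow> ('u dataset \<Rightarrow> real measure) \<Rightarrow> bool" where
  "pdp \<E> M \<longleftrightarrow>
     mechanism M \<and>
     (\<forall>u D D'. neighbours u D D' \<longrightarrow>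
        (\<forall>K \<in> sets borel. measure (M D) K \<le> exp (\<E> u) * measure (M D') K))"

definition normal_law :: "real \<Rightarrow> real \<Rightarrow> real measure" where
  "normal_law \<mu> \<sigma> = density lborel (\<lambda>x. ennreal (normal_density \<mu> \<sigma> x))"

text \<open>
  The law of the output of \<open>M\<close> on the random dataset with users \<open>U\<close> whose values are
  i.i.d. with law \<open>P\<close>; the internal randomness of \<open>M\<close> is independent of the data.
\<close>

definition output_law ::
  "('u dataset \<Rightarrow> real measure) \<Rightarrow> 'u set \<Rightarrow> real measure \<Rightarrow> real measure" where
  "output_law M U P = bind (PiM U (\<lambda>_. P)) (\<lambda>x. M (with_values U x))"

text \<open>The budgets in ascending order with multiplicity; \<open>budgets\<close> is 0-indexed.\<close>

definition budgets :: "('u \<Rightarrow> real) \<Rightarrow> 'u set \<Rightarrow> real list" where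
  "budgets \<E> U = sorted_list_of_multiset (image_mset \<E> (mset_set U))"

definition error_bound :: "real \<Rightarrow> ('u \<Rightarrow> real) \<Rightarrow> 'u set \<Rightarrow> real" where
  "error_bound \<sigma> \<E> U =
     (let n = card U in
      MAX k \<in> {1..n}.
        1 / sqrt 2 * (\<sigma> / ((\<Sum>i = 1..k. budgets \<E> U ! (i - 1)) + 2 * sqrt (real (n - k)))))"

end

theory Submission
  imports Defs
begin

text \<open>
  Two-point method with the means \<open>r\<close> and \<open>- r\<close>, where \<open>r\<close> is the error bound, attained at some
  \<open>k\<close>. Let \<open>W\<close> be the \<open>k\<close> users with the smallest budgets, \<open>S\<close> the sum of these budgets, \<open>V\<close> the
  other users and \<open>s = sqrt (card V)\<close>. The laws of one value under the two means share mass
  \<open>1 - d\<close> with \<open>d \<le> 2 r / (\<sigma> sqrt (2 \<pi>))\<close>. For a user \<open>u\<close> of \<open>W\<close>, compare on the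
  non-shared part with the dataset from which \<open>u\<close> is deleted: this costs a factor \<open>exp (- \<E> u)\<close>
  under both hypotheses. Hence \<open>u\<close> contributes a factor
  \<open>1 - d + d exp (- \<E> u) \<ge> exp (- d \<E> u)\<close> to the sum of the two error probabilities. Passing
  through the common deleted dataset, rather than replacing one value by another at cost
  \<open>exp (2 \<E> u)\<close>, is what makes the constants fit. The values of \<open>V\<close> are given away
  in the clear, and their Hellinger affinity yields the factor \<open>1 - s r / \<sigma>\<close>. The sum of the
  errors is thus at least \<open>exp (- d S) (1 - s r / \<sigma>) \<ge> 1 / 2\<close>, so one of them is at least
  \<open>1 / 4\<close>.
\<close>

section \<open>Convexity, overlap and affinity bounds\<close>

text \<open>Convexity of \<open>exp\<close> on the segment from 0 to \<open>z\<close>. It is used at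
  two scales: with \<open>t = d\<close> and \<open>z = - \<E> u\<close> for the factor of a single
  user, and with \<open>z = - ln 2\<close> when the final constants are balanced.\<close>

lemma exp_mult_le_affine:
  fixes t z :: real
  assumes "0 \<le> t" "t \<le> 1"
  shows "exp (t * z) \<le> 1 - t + t * exp z"
  using convex_onD[OF exp_convex, of t 0 z] assms by simp

text \<open>The law \<open>p\<close> is split into the part \<open>c\<close> shared with the other
  hypothesis and a remainder of mass \<open>d\<close>. On the shared part \<open>F\<close> is kept
  exact; on the remainder it is replaced by its uniform lower bound \<open>a\<close>, which privacy
  will supply.\<close>

lemma density_lower_bound_overlap:
  fixes p c F :: "'a \<Rightarrow> ennreal"
  assumes [measurable]: "p \<in> borel_measurable N" "c \<in> borel_measurable N" "F \<in> borel_measurable N"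
    and le: "\<And>x. c x \<le> p x"
    and p: "(\<integral>\<^sup>+x. p x \<partial>N) = 1" and c: "(\<integral>\<^sup>+x. c x \<partial>N) = ennreal (1 - d)"
    and d: "0 \<le> d" "d \<le> 1"
    and F: "\<And>x. a \<le> F x"
  shows "(\<integral>\<^sup>+x. F x \<partial>density N c) + ennreal d * a \<le> (\<integral>\<^sup>+x. F x \<partial>density N p)"
proof -
  have split: "p x = c x + (p x - c x)" for x
    using le[of x] by (metis add_diff_inverse_ennreal)
  have "1 = (\<integral>\<^sup>+x. c x + (p x - c x) \<partial>N)"
    using split p by simp
  also have "\<dots> = ennreal (1 - d) + (\<integral>\<^sup>+x. p x - c x \<partial>N)"
    by (subst nn_integral_add) (simp_all add: c)
  finally have "ennreal (1 - d) + ennreal d = ennreal (1 - d) + (\<integral>\<^sup>+x. p x - c x \<partial>N)"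
    using d by (simp flip: ennreal_plus)
  \<comment> \<open>Cancellation in \<open>ennreal\<close> is valid here because the shared mass
    \<open>1 - d\<close> is finite.\<close>
  then have rest: "(\<integral>\<^sup>+x. p x - c x \<partial>N) = ennreal d"
    by (metis ennreal_add_left_cancel ennreal_neq_top infinity_ennreal_def)
  have "(\<integral>\<^sup>+x. F x \<partial>density N c) + ennreal d * a
      = (\<integral>\<^sup>+x. c x * F x \<partial>N) + (\<integral>\<^sup>+x. (p x - c x) * a \<partial>N)"
    by (simp add: nn_integral_density nn_integral_multc rest)
  also have "\<dots> = (\<integral>\<^sup>+x. c x * F x + (p x - c x) * a \<partial>N)"
    by (rule nn_integral_add[symmetric]) auto
  also have "\<dots> \<le> (\<integral>\<^sup>+x. p x * F x \<partial>N)"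
  proof (rule nn_integral_mono)
    fix x
    have "c x * F x + (p x - c x) * a \<le> c x * F x + (p x - c x) * F x"
      by (intro add_left_mono mult_left_mono F) auto
    also have "\<dots> = p x * F x"
      by (metis split distrib_right)
    finally show "c x * F x + (p x - c x) * a \<le> p x * F x" .
  qed
  also have "\<dots> = (\<integral>\<^sup>+x. F x \<partial>density N p)"
    by (simp add: nn_integral_density)
  finally show ?thesis .
qed

text \<open>Both sides agree on boxes, where the integral of a product factorises. This turns an
  i.i.d. sample into a single law with a density, so that a test on the whole sample can be treated
  as one binary testing problem.\<close>

lemma (in product_sigma_finite) PiM_density:
  assumes I: "finite I" and f[measurable]: "\<And>i. i \<in> I \<Longrightarrow> f i \<in> borel_measurable (M i)"
    and sf: "\<And>i. sigma_finite_measure (density (M i) (f i))"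
  shows "PiM I (\<lambda>i. density (M i) (f i)) = density (PiM I M) (\<lambda>x. \<Prod>i\<in>I. f i (x i))"
proof -
  interpret D: product_sigma_finite "\<lambda>i. density (M i) (f i)"
    by (rule product_sigma_finite.intro) (rule sf)
  have "density (PiM I M) (\<lambda>x. \<Prod>i\<in>I. f i (x i)) = PiM I (\<lambda>i. density (M i) (f i))"
  proof (rule D.PiM_eqI[OF I])
    show "sets (density (PiM I M) (\<lambda>x. \<Prod>i\<in>I. f i (x i))) = sets (PiM I (\<lambda>i. density (M i) (f i)))"
      by (simp cong: sets_PiM_cong)
    fix A assume A: "\<And>i. i \<in> I \<Longrightarrow> A i \<in> sets (density (M i) (f i))"
    then have A'[measurable]: "\<And>i. i \<in> I \<Longrightarrow> A i \<in> sets (M i)" by simp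
    have "emeasure (density (PiM I M) (\<lambda>x. \<Prod>i\<in>I. f i (x i))) (Pi\<^sub>E I A)
        = (\<integral>\<^sup>+x. (\<Prod>i\<in>I. f i (x i)) * indicator (Pi\<^sub>E I A) x \<partial>PiM I M)"
      using I A' by (subst emeasure_density) (auto intro!: borel_measurable_prod_ennreal)
    also have "\<dots> = (\<integral>\<^sup>+x. (\<Prod>i\<in>I. f i (x i) * indicator (A i) (x i)) \<partial>PiM I M)"
    proof (rule nn_integral_cong)
      fix x assume "x \<in> space (PiM I M)"
      then have "indicator (Pi\<^sub>E I A) x = (\<Prod>i\<in>I. indicator (A i) (x i) :: ennreal)"
        using I by (auto simp: indicator_def space_PiM PiE_def Pi_def)
      then show "(\<Prod>i\<in>I. f i (x i)) * indicator (Pi\<^sub>E I A) x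
          = (\<Prod>i\<in>I. f i (x i) * indicator (A i) (x i))"
        by (simp add: prod.distrib)
    qed
    also have "\<dots> = (\<Prod>i\<in>I. \<integral>\<^sup>+x. f i x * indicator (A i) x \<partial>M i)"
      by (rule product_nn_integral_prod[OF I]) auto
    also have "\<dots> = (\<Prod>i\<in>I. emeasure (density (M i) (f i)) (A i))"
      by (intro prod.cong refl) (simp add: emeasure_density)
    finally show "emeasure (density (PiM I M) (\<lambda>x. \<Prod>i\<in>I. f i (x i))) (Pi\<^sub>E I A)
        = (\<Prod>i\<in>I. emeasure (density (M i) (f i)) (A i))" .
  qed
  then show ?thesis ..
qed

text \<open>Here \<open>b\<close> is the Hellinger affinity of the two laws. A weighted AM-GM inequality for the
  densities, with the weight optimised at the end, replaces Cauchy--Schwarz.\<close>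

lemma testing_error_affinity:
  fixes p q m :: "'a \<Rightarrow> real" and h k :: "'a \<Rightarrow> ennreal"
  assumes [measurable]: "p \<in> borel_measurable N" "q \<in> borel_measurable N" "m \<in> borel_measurable N"
      "h \<in> borel_measurable N" "k \<in> borel_measurable N"
    and nn: "\<And>x. 0 \<le> p x" "\<And>x. 0 \<le> q x" "\<And>x. 0 \<le> m x"
    and int: "(\<integral>\<^sup>+x. p x \<partial>N) = 1" "(\<integral>\<^sup>+x. q x \<partial>N) = 1" "(\<integral>\<^sup>+x. m x \<partial>N) = 1"
    and b: "\<And>x. p x * q x = (b * m x)\<^sup>2" "0 \<le> b"
    and t: "0 \<le> t" "t < 1" "1 - t\<^sup>2 \<le> b\<^sup>2"
    and hk: "\<And>x. x \<in> space N \<Longrightarrow> h x + k x = 1"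
  shows "ennreal (1 - t) \<le> (\<integral>\<^sup>+x. h x \<partial>density N p) + (\<integral>\<^sup>+x. k x \<partial>density N q)"
proof -
  \<comment> \<open>AM-GM for \<open>l * u\<close> and \<open>v / l\<close>, whose geometric mean is
    \<open>b * m x\<close> for every weight \<open>l\<close>.\<close>
  have amgm: "b * m x \<le> l / 2 * u + v / (2 * l)"
    if l0: "0 < l" and that: "u * v = (b * m x)\<^sup>2" "0 \<le> u" "0 \<le> v" for l u v x
  proof (rule power2_le_imp_le)
    have "(l / 2 * u + v / (2 * l))\<^sup>2 - u * v = (l / 2 * u - v / (2 * l))\<^sup>2"
      using l0 by (simp add: power2_eq_square field_simps)
    then show "(b * m x)\<^sup>2 \<le> (l / 2 * u + v / (2 * l))\<^sup>2"
      using that(1) by (smt (verit) zero_le_power2)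
  qed (use that l0 in simp)
  have step: "ennreal b * (\<integral>\<^sup>+x. ennreal (m x) * f x \<partial>N)
      \<le> ennreal (l / 2) * (\<integral>\<^sup>+x. ennreal (u x) * f x \<partial>N)
        + ennreal (1 / (2 * l)) * (\<integral>\<^sup>+x. ennreal (v x) * f x \<partial>N)"
    if l0: "0 < l" and uv: "\<And>x. u x * v x = (b * m x)\<^sup>2" "\<And>x. 0 \<le> u x" "\<And>x. 0 \<le> v x"
      and [measurable]: "f \<in> borel_measurable N" "u \<in> borel_measurable N" "v \<in> borel_measurable N"
    for l f u v
  proof -
    have "ennreal b * (\<integral>\<^sup>+x. ennreal (m x) * f x \<partial>N) = (\<integral>\<^sup>+x. ennreal (b * m x) * f x \<partial>N)"
      using b(2) nn by (simp add: nn_integral_cmult[symmetric] ennreal_mult mult.assoc)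
    also have "\<dots> \<le> (\<integral>\<^sup>+x. ennreal (l / 2) * (ennreal (u x) * f x)
        + ennreal (1 / (2 * l)) * (ennreal (v x) * f x) \<partial>N)"
    proof (rule nn_integral_mono)
      fix x
      have "ennreal (b * m x) \<le> ennreal (l / 2 * u x + 1 / (2 * l) * v x)"
        using amgm[OF l0 uv] by (intro ennreal_leI) simp
      also have "\<dots> = ennreal (l / 2) * ennreal (u x) + ennreal (1 / (2 * l)) * ennreal (v x)"
        using uv(2,3)[of x] l0 by (subst ennreal_plus) (simp_all flip: ennreal_mult')
      finally have "ennreal (b * m x) * f x
          \<le> (ennreal (l / 2) * ennreal (u x) + ennreal (1 / (2 * l)) * ennreal (v x)) * f x"
        by (rule mult_right_mono) simp
      then show "ennreal (b * m x) * f x \<le> ennreal (l / 2) * (ennreal (u x) * f x)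
        + ennreal (1 / (2 * l)) * (ennreal (v x) * f x)"
        by (simp add: distrib_right mult.assoc)
    qed
    also have "\<dots> = ennreal (l / 2) * (\<integral>\<^sup>+x. ennreal (u x) * f x \<partial>N)
        + ennreal (1 / (2 * l)) * (\<integral>\<^sup>+x. ennreal (v x) * f x \<partial>N)"
      by (subst nn_integral_add) (simp_all add: nn_integral_cmult)
    finally show ?thesis .
  qed
  have total: "(\<integral>\<^sup>+x. ennreal (u x) * h x \<partial>N) + (\<integral>\<^sup>+x. ennreal (u x) * k x \<partial>N) = 1"
    if "(\<integral>\<^sup>+x. ennreal (u x) \<partial>N) = 1" and [measurable]: "u \<in> borel_measurable N" for u
  proof -
    have "(\<integral>\<^sup>+x. ennreal (u x) * h x \<partial>N) + (\<integral>\<^sup>+x. ennreal (u x) * k x \<partial>N)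
        = (\<integral>\<^sup>+x. ennreal (u x) * h x + ennreal (u x) * k x \<partial>N)"
      by (rule nn_integral_add[symmetric]) auto
    also have "\<dots> = (\<integral>\<^sup>+x. ennreal (u x) \<partial>N)"
      by (rule nn_integral_cong) (metis distrib_left hk mult.right_neutral)
    finally show ?thesis using that(1) by simp
  qed
  have fin: "(\<integral>\<^sup>+x. ennreal (u x) * f x \<partial>N) \<noteq> \<top>" if "(\<integral>\<^sup>+x. ennreal (u x) \<partial>N) = 1" "f = h \<or> f = k"
      and [measurable]: "u \<in> borel_measurable N" for u f
    using total[OF that(1,3)] that(2)
    by (metis ennreal_add_eq_top ennreal_one_neq_top)
  \<comment> \<open>\<open>A\<close> and \<open>B\<close> are the two error probabilities of the
    test, \<open>A'\<close> and \<open>B'\<close> the complementary probabilities of deciding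
    correctly.\<close>
  define A where "A = enn2real (\<integral>\<^sup>+x. ennreal (p x) * h x \<partial>N)"
  define A' where "A' = enn2real (\<integral>\<^sup>+x. ennreal (p x) * k x \<partial>N)"
  define B where "B = enn2real (\<integral>\<^sup>+x. ennreal (q x) * k x \<partial>N)"
  define B' where "B' = enn2real (\<integral>\<^sup>+x. ennreal (q x) * h x \<partial>N)"
  have eqs: "(\<integral>\<^sup>+x. ennreal (p x) * h x \<partial>N) = ennreal A" "(\<integral>\<^sup>+x. ennreal (p x) * k x \<partial>N) = ennreal A'"
      "(\<integral>\<^sup>+x. ennreal (q x) * k x \<partial>N) = ennreal B" "(\<integral>\<^sup>+x. ennreal (q x) * h x \<partial>N) = ennreal B'"
    unfolding A_def A'_def B_def B'_def using int fin
    by (auto simp: ennreal_enn2real_if)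
  have pos: "0 \<le> A" "0 \<le> A'" "0 \<le> B" "0 \<le> B'"
    by (simp_all add: A_def A'_def B_def B'_def)
  have AA: "A + A' = 1" "B + B' = 1"
    using total[OF int(1)] total[OF int(2)] pos unfolding eqs
    by (simp_all add: add.commute flip: ennreal_plus)
  \<comment> \<open>The weighted inequality is applied to \<open>(p, q)\<close> against
    \<open>h\<close> and to \<open>(q, p)\<close> against \<open>k\<close>. With this swap both
    errors receive the weight \<open>l / 2\<close> and both complements the weight
    \<open>1 / (2 * l)\<close>.\<close>
  have key: "b \<le> l / 2 * (A + B) + (2 - (A + B)) / (2 * l)" if l0: "0 < l" for l
  proof -
    have "ennreal b
        = ennreal b * (\<integral>\<^sup>+x. ennreal (m x) * h x \<partial>N) + ennreal b * (\<integral>\<^sup>+x. ennreal (m x) * k x \<partial>N)"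
      using total[OF int(3)] by (simp flip: distrib_left)
    also have "\<dots> \<le> (ennreal (l / 2) * ennreal A + ennreal (1 / (2 * l)) * ennreal B')
        + (ennreal (l / 2) * ennreal B + ennreal (1 / (2 * l)) * ennreal A')"
      unfolding eqs[symmetric] using nn b by (intro add_mono step l0) (auto simp: mult.commute)
    also have "\<dots> = ennreal ((l / 2 * A + 1 / (2 * l) * B') + (l / 2 * B + 1 / (2 * l) * A'))"
      using pos l0 by (simp flip: ennreal_mult' ennreal_plus)
    finally have "b \<le> (l / 2 * A + 1 / (2 * l) * B') + (l / 2 * B + 1 / (2 * l) * A')"
      by (subst (asm) ennreal_le_iff) (use pos l0 in auto)
    also have "\<dots> = l / 2 * (A + B) + (A' + B') / (2 * l)"
      using l0 by (simp add: field_simps)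
    also have "A' + B' = 2 - (A + B)"
      using AA by simp
    finally show ?thesis .
  qed
  have "1 - t \<le> A + B"
  proof (rule ccontr)
    assume "\<not> ?thesis"
    then have s: "A + B < 1 - t" by simp
    \<comment> \<open>A midpoint, chosen so that \<open>t \<le> r\<close> and
      \<open>A + B < 1 - r\<close> hold while \<open>r\<close> is strictly positive even if
      \<open>t = 0\<close>. This forces \<open>l > 1\<close> below.\<close>
    define r where "r = (t + (1 - (A + B))) / 2"
    have r: "0 < r" "r < 1" "t \<le> r" "A + B < 1 - r"
      using s t(1,2) pos by (simp_all add: r_def field_simps)
    \<comment> \<open>This weight minimises \<open>l / 2 * (1 - r) + (1 + r) / (2 * l)\<close>; the
      minimum is \<open>sqrt (1 - r\<^sup>2)\<close>. As \<open>l > 1\<close>, the bound in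
      \<open>key\<close> increases with \<open>A + B\<close>, so \<open>A + B\<close> may be
      replaced by \<open>1 - r\<close>.\<close>
    define l where "l = sqrt ((1 + r) / (1 - r))"
    have l: "1 < l" and l2: "l\<^sup>2 * (1 - r) = 1 + r"
      using r unfolding l_def by (auto simp: field_simps)
    have "l / 2 * (A + B) + (2 - (A + B)) / (2 * l) = (l\<^sup>2 - 1) / (2 * l) * (A + B) + 1 / l"
      using l by (simp add: field_simps power2_eq_square)
    also have "\<dots> < (l\<^sup>2 - 1) / (2 * l) * (1 - r) + 1 / l"
      using l r by (intro add_strict_right_mono mult_strict_left_mono) (auto simp: power2_eq_square less_1_mult)
    also have "\<dots> = (l\<^sup>2 * (1 - r) + (1 + r)) / (2 * l)"
      using l by (simp add: field_simps)
    also have "\<dots> = l * (1 - r)"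
      unfolding l2[symmetric] using l by (simp add: field_simps power2_eq_square)
    finally have "b < l * (1 - r)"
      using key[of l] l by linarith
    then have "b\<^sup>2 < (l * (1 - r))\<^sup>2"
      using b(2) by (simp add: power_strict_mono)
    also have "\<dots> = (l\<^sup>2 * (1 - r)) * (1 - r)"
      by (simp add: power2_eq_square)
    also have "\<dots> = 1 - r\<^sup>2"
      unfolding l2 by (simp add: power2_eq_square algebra_simps)
    also have "\<dots> \<le> 1 - t\<^sup>2"
      using r t by (simp add: power_mono)
    finally show False using t by simp
  qed
  then show ?thesis
    using pos by (simp add: nn_integral_density eqs flip: ennreal_plus)
qed


section \<open>Private tests and the recursion over users\<close>

text \<open>\<open>f S x\<close> and \<open>g S x\<close> stand for the probabilities that a mechanism accepts, respectively
  rejects, on the dataset with users \<open>S\<close> and values \<open>x\<close>. Only the lower bounds for adding a user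
  are needed; in this form the property is inherited when the value of one user is fixed.\<close>

definition dp_test ::
  "('u \<Rightarrow> real) \<Rightarrow> 'u set \<Rightarrow> ('u set \<Rightarrow> ('u \<Rightarrow> real) \<Rightarrow> ennreal) \<Rightarrow>
    ('u set \<Rightarrow> ('u \<Rightarrow> real) \<Rightarrow> ennreal) \<Rightarrow> bool" where
  "dp_test \<E> T f g \<longleftrightarrow>
     (\<forall>S\<subseteq>T. f S \<in> borel_measurable (PiM S (\<lambda>_. borel)) \<and> g S \<in> borel_measurable (PiM S (\<lambda>_. borel))) \<and>
     (\<forall>S\<subseteq>T. \<forall>x\<in>extensional S. f S x + g S x = 1) \<and>
     (\<forall>S\<subseteq>T. \<forall>u\<in>T - S. \<forall>x\<in>extensional S. \<forall>y.
        ennreal (exp (- \<E> u)) * f S x \<le> f (insert u S) (x(u := y)) \<and>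
        ennreal (exp (- \<E> u)) * g S x \<le> g (insert u S) (x(u := y)))"

lemma dp_test_subset: "dp_test \<E> T f g \<Longrightarrow> T' \<subseteq> T \<Longrightarrow> dp_test \<E> T' f g"
  unfolding dp_test_def by (meson Diff_mono order_trans subset_iff subset_refl)

lemma measurable_fun_upd_const:
  assumes "y \<in> space (M i)"
  shows "(\<lambda>x. x(i := y)) \<in> PiM S M \<rightarrow>\<^sub>M PiM (insert i S) M"
  using measurable_compose[OF measurable_Pair[OF measurable_ident measurable_const[OF assms]] measurable_add_dim[of i S M]]
  by simp

lemma dp_test_insert:
  assumes "dp_test \<E> (insert w T) f g" "w \<notin> T"
  shows "dp_test \<E> T (\<lambda>S x. f (insert w S) (x(w := y))) (\<lambda>S x. g (insert w S) (x(w := y)))"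
proof -
  note d = assms(1)[unfolded dp_test_def]
  have ext: "x(w := y) \<in> extensional (insert w S)" if "x \<in> extensional S" for x :: "'a \<Rightarrow> real" and S
    using that by (auto simp: extensional_def)
  have upd: "(\<lambda>x. x(w := y)) \<in> PiM S (\<lambda>_. borel) \<rightarrow>\<^sub>M PiM (insert w S) (\<lambda>_. borel :: real measure)" for S
    by (rule measurable_fun_upd_const) simp
  show ?thesis
    unfolding dp_test_def
  proof (intro conjI allI impI ballI)
    fix S assume S: "S \<subseteq> T"
    then have S': "insert w S \<subseteq> insert w T" by auto
    show "(\<lambda>x. f (insert w S) (x(w := y))) \<in> borel_measurable (PiM S (\<lambda>_. borel))"
      by (rule measurable_compose[OF upd]) (use d S' in blast)
    show "(\<lambda>x. g (insert w S) (x(w := y))) \<in> borel_measurable (PiM S (\<lambda>_. borel))"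
      by (rule measurable_compose[OF upd]) (use d S' in blast)
    fix x :: "'a \<Rightarrow> real" assume x: "x \<in> extensional S"
    show "f (insert w S) (x(w := y)) + g (insert w S) (x(w := y)) = 1"
      using d S' ext[OF x] by blast
    fix u z assume u: "u \<in> T - S"
    then have u': "u \<in> insert w T - insert w S" "u \<noteq> w"
      using assms(2) by auto
    have sw: "insert w (insert u S) = insert u (insert w S)" "x(u := z, w := y) = x(w := y, u := z)"
      using u'(2) by (auto simp: fun_upd_twist)
    show "ennreal (exp (- \<E> u)) * f (insert w S) (x(w := y)) \<le> f (insert w (insert u S)) (x(u := z, w := y))"
      unfolding sw using d S' ext[OF x] u'(1) by blast
    show "ennreal (exp (- \<E> u)) * g (insert w S) (x(w := y)) \<le> g (insert w (insert u S)) (x(u := z, w := y))"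
      unfolding sw using d S' ext[OF x] u'(1) by blast
  qed
qed

text \<open>Induction that peels the users of \<open>W\<close> off one by one. The tests stay
  arbitrary because the hypothesis is used for two of them: the one with the value of
  \<open>w\<close> frozen, and the original one restricted to the datasets without
  \<open>w\<close>.\<close>

lemma dp_test_lower_bound:
  fixes p q c :: "real \<Rightarrow> ennreal" and \<E> :: "'u \<Rightarrow> real"
  assumes pqc[measurable]: "p \<in> borel_measurable borel" "q \<in> borel_measurable borel" "c \<in> borel_measurable borel"
    and le: "\<And>x. c x \<le> p x" "\<And>x. c x \<le> q x"
    and int: "(\<integral>\<^sup>+x. p x \<partial>lborel) = 1" "(\<integral>\<^sup>+x. q x \<partial>lborel) = 1" "(\<integral>\<^sup>+x. c x \<partial>lborel) = ennreal (1 - d)"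
    and d: "0 \<le> d" "d \<le> 1"
    and fin: "finite W" "finite V" "W \<inter> V = {}"
    and base: "\<And>f g. dp_test \<E> V f g \<Longrightarrow>
        b \<le> (\<integral>\<^sup>+x. f V x \<partial>PiM V (\<lambda>_. density lborel p)) + (\<integral>\<^sup>+x. g V x \<partial>PiM V (\<lambda>_. density lborel q))"
    and fg: "dp_test \<E> (W \<union> V) f g"
  shows "(\<Prod>u\<in>W. ennreal (1 - d + d * exp (- \<E> u))) * b
      \<le> (\<integral>\<^sup>+x. f (W \<union> V) x \<partial>PiM (W \<union> V) (\<lambda>_. density lborel p))
        + (\<integral>\<^sup>+x. g (W \<union> V) x \<partial>PiM (W \<union> V) (\<lambda>_. density lborel q))"
  using fin(1,3) fg
proof (induction W arbitrary: f g rule: finite_induct)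
  case empty
  then show ?case using base by simp
next
  case (insert w W)
  let ?P = "density lborel p" and ?Q = "density lborel q" and ?C = "density lborel c"
  let ?I = "W \<union> V"
  interpret P: prob_space ?P by (rule prob_spaceI) (simp add: emeasure_density int)
  interpret Q: prob_space ?Q by (rule prob_spaceI) (simp add: emeasure_density int)
  interpret PP: product_prob_space "\<lambda>_. ?P" ?I by standard
  interpret QQ: product_prob_space "\<lambda>_. ?Q" ?I by standard
  have I: "finite ?I" "w \<notin> ?I"
    using insert fin(2) by auto
  have dI: "dp_test \<E> (insert w ?I) f g"
    using insert.prems by simp
  note dd = dI[unfolded dp_test_def]
  \<comment> \<open>\<open>F y\<close> and \<open>G y\<close> are the errors given that
    \<open>w\<close> carries the value \<open>y\<close>; \<open>F0\<close> and \<open>G0\<close> are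
    the errors when \<open>w\<close> is absent.\<close>
  define F where "F y = (\<integral>\<^sup>+x. f (insert w ?I) (x(w := y)) \<partial>PiM ?I (\<lambda>_. ?P))" for y
  define G where "G y = (\<integral>\<^sup>+x. g (insert w ?I) (x(w := y)) \<partial>PiM ?I (\<lambda>_. ?Q))" for y
  define F0 where "F0 = (\<integral>\<^sup>+x. f ?I x \<partial>PiM ?I (\<lambda>_. ?P))"
  define G0 where "G0 = (\<integral>\<^sup>+x. g ?I x \<partial>PiM ?I (\<lambda>_. ?Q))"
  define \<beta> where "\<beta> = (\<Prod>u\<in>W. ennreal (1 - d + d * exp (- \<E> u))) * b"
  have IH: "\<beta> \<le> F y + G y" for y
    unfolding F_def G_def \<beta>_def
    using insert.prems by (intro insert.IH dp_test_insert[OF dI I(2)]) auto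
  have IH0: "\<beta> \<le> F0 + G0"
    unfolding F0_def G0_def \<beta>_def
    using insert.prems by (intro insert.IH dp_test_subset[OF dI]) auto
  have meas: "f (insert w ?I) \<in> borel_measurable (PiM (insert w ?I) (\<lambda>_. borel))"
      "g (insert w ?I) \<in> borel_measurable (PiM (insert w ?I) (\<lambda>_. borel))"
      "f ?I \<in> borel_measurable (PiM ?I (\<lambda>_. borel))"
      "g ?I \<in> borel_measurable (PiM ?I (\<lambda>_. borel))"
    using dd by blast+
  have setsP: "sets (PiM S (\<lambda>_. ?P)) = sets (PiM S (\<lambda>_. borel))"
    and setsQ: "sets (PiM S (\<lambda>_. ?Q)) = sets (PiM S (\<lambda>_. borel))" for S :: "'u set"
    by (auto intro!: sets_PiM_cong)
  have measP[measurable]: "f (insert w ?I) \<in> borel_measurable (PiM (insert w ?I) (\<lambda>_. ?P))"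
      "f ?I \<in> borel_measurable (PiM ?I (\<lambda>_. ?P))"
    using meas by (simp_all add: measurable_cong_sets[OF setsP refl])
  have measQ[measurable]: "g (insert w ?I) \<in> borel_measurable (PiM (insert w ?I) (\<lambda>_. ?Q))"
      "g ?I \<in> borel_measurable (PiM ?I (\<lambda>_. ?Q))"
    using meas by (simp_all add: measurable_cong_sets[OF setsQ refl])
  have "F \<in> borel_measurable ?P" unfolding F_def
    by (rule PP.P.borel_measurable_nn_integral) measurable
  then have [measurable]: "F \<in> borel_measurable borel" by simp
  have "G \<in> borel_measurable ?Q" unfolding G_def
    by (rule QQ.P.borel_measurable_nn_integral) measurable
  then have [measurable]: "G \<in> borel_measurable borel" by simp
  \<comment> \<open>The bound is uniform in \<open>y\<close>, as the overlap lemma demands of its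
    constant \<open>a\<close>.\<close>
  have F: "ennreal (exp (- \<E> w)) * F0 \<le> F y" for y
  proof -
    have "ennreal (exp (- \<E> w)) * F0 = (\<integral>\<^sup>+x. ennreal (exp (- \<E> w)) * f ?I x \<partial>PiM ?I (\<lambda>_. ?P))"
      unfolding F0_def by (rule nn_integral_cmult[symmetric]) measurable
    also have "\<dots> \<le> F y"
      unfolding F_def
    proof (rule nn_integral_mono)
      fix x assume "x \<in> space (PiM ?I (\<lambda>_. ?P))"
      then have "x \<in> extensional ?I"
        by (simp add: space_PiM PiE_def)
      moreover have "?I \<subseteq> insert w ?I" "w \<in> insert w ?I - ?I"
        using I(2) by auto
      ultimately show "ennreal (exp (- \<E> w)) * f ?I x \<le> f (insert w ?I) (x(w := y))"
        using dd by blast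
    qed
    finally show ?thesis .
  qed
  have G: "ennreal (exp (- \<E> w)) * G0 \<le> G y" for y
  proof -
    have "ennreal (exp (- \<E> w)) * G0 = (\<integral>\<^sup>+x. ennreal (exp (- \<E> w)) * g ?I x \<partial>PiM ?I (\<lambda>_. ?Q))"
      unfolding G0_def by (rule nn_integral_cmult[symmetric]) measurable
    also have "\<dots> \<le> G y"
      unfolding G_def
    proof (rule nn_integral_mono)
      fix x assume "x \<in> space (PiM ?I (\<lambda>_. ?Q))"
      then have "x \<in> extensional ?I"
        by (simp add: space_PiM PiE_def)
      moreover have "?I \<subseteq> insert w ?I" "w \<in> insert w ?I - ?I"
        using I(2) by auto
      ultimately show "ennreal (exp (- \<E> w)) * g ?I x \<le> g (insert w ?I) (x(w := y))"
        using dd by blast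
    qed
    finally show ?thesis .
  qed
  have "(\<Prod>u\<in>insert w W. ennreal (1 - d + d * exp (- \<E> u))) * b
      = ennreal (1 - d + d * exp (- \<E> w)) * \<beta>"
    using insert.hyps by (simp add: \<beta>_def mult.assoc)
  also have "\<dots> = ennreal (1 - d) * \<beta> + ennreal d * (ennreal (exp (- \<E> w)) * \<beta>)"
    using d by (simp add: ennreal_mult distrib_right mult.assoc)
  \<comment> \<open>The measure \<open>?C\<close> is common to both hypotheses, so the same
    \<open>y\<close> enters both errors and the induction hypothesis applies under the integral. On
    the remainders the value of \<open>w\<close> follows different laws under the two hypotheses;
    there both errors are compared with the absence of \<open>w\<close>, where the induction
    hypothesis bounds \<open>F0 + G0\<close>.\<close>
  also have "\<dots> \<le> (\<integral>\<^sup>+y. F y + G y \<partial>?C) + ennreal d * (ennreal (exp (- \<E> w)) * (F0 + G0))"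
  proof (intro add_mono mult_left_mono IH0)
    have "ennreal (1 - d) * \<beta> = (\<integral>\<^sup>+y. \<beta> \<partial>?C)"
      by (simp add: emeasure_density int mult.commute)
    also have "\<dots> \<le> (\<integral>\<^sup>+y. F y + G y \<partial>?C)"
      by (intro nn_integral_mono IH)
    finally show "ennreal (1 - d) * \<beta> \<le> (\<integral>\<^sup>+y. F y + G y \<partial>?C)" .
  qed auto
  also have "\<dots> = ((\<integral>\<^sup>+y. F y \<partial>?C) + ennreal d * (ennreal (exp (- \<E> w)) * F0))
      + ((\<integral>\<^sup>+y. G y \<partial>?C) + ennreal d * (ennreal (exp (- \<E> w)) * G0))"
    by (subst nn_integral_add) (simp_all add: algebra_simps)
  also have "\<dots> \<le> (\<integral>\<^sup>+y. F y \<partial>?P) + (\<integral>\<^sup>+y. G y \<partial>?Q)"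
    by (intro add_mono density_lower_bound_overlap le int d F G) auto
  also have "(\<integral>\<^sup>+y. F y \<partial>?P) = (\<integral>\<^sup>+x. f (insert w ?I) x \<partial>PiM (insert w ?I) (\<lambda>_. ?P))"
    unfolding F_def by (rule PP.product_nn_integral_insert_rev[OF I, symmetric]) measurable
  also have "(\<integral>\<^sup>+y. G y \<partial>?Q) = (\<integral>\<^sup>+x. g (insert w ?I) x \<partial>PiM (insert w ?I) (\<lambda>_. ?Q))"
    unfolding G_def by (rule QQ.product_nn_integral_insert_rev[OF I, symmetric]) measurable
  finally show ?case by simp
qed

section \<open>Two normal laws with opposite means\<close>

text \<open>The integrand is the pointwise minimum of the densities with means \<open>r\<close> and
  \<open>- r\<close>. It arises from the centred density by cutting out the strip between
  \<open>- r\<close> and \<open>r\<close> and sliding the two tails together. The strip has width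
  \<open>2 * r\<close> and height at most \<open>1 / (\<sigma> * sqrt (2 * pi))\<close>.\<close>

lemma normal_density_overlap:
  fixes \<sigma> r :: real
  assumes \<sigma>: "0 < \<sigma>" and r: "0 \<le> r"
  shows "1 \<le> (\<integral>\<^sup>+x. ennreal (normal_density 0 \<sigma> (\<bar>x\<bar> + r)) \<partial>lborel) + ennreal (2 * r / (\<sigma> * sqrt (2 * pi)))"
proof -
  let ?n = "\<lambda>x. ennreal (normal_density 0 \<sigma> x)"
  have right: "(\<integral>\<^sup>+x. ?n x * indicator {r..} x \<partial>lborel)
      = (\<integral>\<^sup>+x. ?n (\<bar>x\<bar> + r) * indicator {0..} x \<partial>lborel)"
    by (subst nn_integral_real_affine[where c = 1 and t = r])
       (auto intro!: nn_integral_cong simp: indicator_def add.commute)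
  have left: "(\<integral>\<^sup>+x. ?n x * indicator {..<-r} x \<partial>lborel)
      = (\<integral>\<^sup>+x. ?n (\<bar>x\<bar> + r) * indicator {..<0} x \<partial>lborel)"
    by (subst nn_integral_real_affine[where c = 1 and t = "- r"])
       (auto intro!: nn_integral_cong simp: indicator_def normal_density_def power2_commute)
  have "1 = (\<integral>\<^sup>+x. ?n x \<partial>lborel)"
    using prob_space.emeasure_space_1[OF prob_space_normal_density[OF \<sigma>, of 0]] by (simp add: emeasure_density)
  also have "\<dots> = (\<integral>\<^sup>+x. (?n x * indicator {r..} x + ?n x * indicator {..<-r} x) + ?n x * indicator {-r..<r} x \<partial>lborel)"
    using r by (intro nn_integral_cong) (auto simp: indicator_def)
  also have "\<dots> = ((\<integral>\<^sup>+x. ?n x * indicator {r..} x \<partial>lborel) + (\<integral>\<^sup>+x. ?n x * indicator {..<-r} x \<partial>lborel))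
      + (\<integral>\<^sup>+x. ?n x * indicator {-r..<r} x \<partial>lborel)"
    by (simp add: nn_integral_add)
  also have "(\<integral>\<^sup>+x. ?n x * indicator {r..} x \<partial>lborel) + (\<integral>\<^sup>+x. ?n x * indicator {..<-r} x \<partial>lborel)
      = (\<integral>\<^sup>+x. ?n (\<bar>x\<bar> + r) * indicator {0..} x + ?n (\<bar>x\<bar> + r) * indicator {..<0} x \<partial>lborel)"
    unfolding left right by (rule nn_integral_add[symmetric]) auto
  also have "\<dots> = (\<integral>\<^sup>+x. ?n (\<bar>x\<bar> + r) \<partial>lborel)"
    by (intro nn_integral_cong) (auto simp: indicator_def)
  also have "(\<integral>\<^sup>+x. ?n x * indicator {-r..<r} x \<partial>lborel)
      \<le> (\<integral>\<^sup>+x. ennreal (1 / (\<sigma> * sqrt (2 * pi))) * indicator {-r..<r} x \<partial>lborel)"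
  proof (intro nn_integral_mono mult_right_mono ennreal_leI)
    fix x :: real
    have "normal_density 0 \<sigma> x \<le> 1 / sqrt (2 * pi * \<sigma>\<^sup>2) * 1"
      unfolding normal_density_def by (intro mult_left_mono) auto
    also have "\<dots> = 1 / (\<sigma> * sqrt (2 * pi))"
      using \<sigma> by (simp add: real_sqrt_mult)
    finally show "normal_density 0 \<sigma> x \<le> 1 / (\<sigma> * sqrt (2 * pi))" .
  qed auto
  also have "\<dots> = ennreal (1 / (\<sigma> * sqrt (2 * pi))) * ennreal (2 * r)"
    using r by (subst nn_integral_cmult_indicator) auto
  also have "\<dots> = ennreal (2 * r / (\<sigma> * sqrt (2 * pi)))"
    using r \<sigma> by (simp flip: ennreal_mult)
  finally show ?thesis by (simp add: add_left_mono)
qed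

text \<open>The geometric mean of the two densities is a multiple of the centred normal density, and
  the multiple is their Hellinger affinity. This is the form in which
  \<open>testing_error_affinity\<close> takes the affinity.\<close>

lemma normal_density_mult_opposite:
  "normal_density r \<sigma> y * normal_density (- r) \<sigma> y = (exp (- r\<^sup>2 / (2 * \<sigma>\<^sup>2)) * normal_density 0 \<sigma> y)\<^sup>2"
proof -
  have "- (y - r)\<^sup>2 / (2 * \<sigma>\<^sup>2) + - (y - - r)\<^sup>2 / (2 * \<sigma>\<^sup>2)
      = 2 * (- r\<^sup>2 / (2 * \<sigma>\<^sup>2) + - (y - 0)\<^sup>2 / (2 * \<sigma>\<^sup>2))"
    by (simp add: power2_eq_square algebra_simps add_divide_distrib diff_divide_distrib)
  then have "exp (- (y - r)\<^sup>2 / (2 * \<sigma>\<^sup>2)) * exp (- (y - - r)\<^sup>2 / (2 * \<sigma>\<^sup>2))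
      = (exp (- r\<^sup>2 / (2 * \<sigma>\<^sup>2)) * exp (- (y - 0)\<^sup>2 / (2 * \<sigma>\<^sup>2)))\<^sup>2"
    by (metis exp_add exp_double)
  then show ?thesis
    unfolding normal_density_def by (simp add: power_mult_distrib power2_eq_square mult.assoc mult.left_commute)
qed

text \<open>The affinity is multiplicative over the sample. Its square is
  \<open>exp (- t\<^sup>2) \<ge> 1 - t\<^sup>2\<close> with
  \<open>t = sqrt (card V) * r / \<sigma>\<close>, so any test has total error at least
  \<open>1 - t\<close>.\<close>

lemma normal_sample_testing_error:
  fixes h k :: "('u \<Rightarrow> real) \<Rightarrow> ennreal"
  assumes \<sigma>: "0 < \<sigma>" and r: "0 \<le> r" and V: "finite V"
    and t: "sqrt (real (card V)) * r / \<sigma> < 1"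
    and meas: "h \<in> borel_measurable (PiM V (\<lambda>_. borel))" "k \<in> borel_measurable (PiM V (\<lambda>_. borel))"
    and hk: "\<And>x. x \<in> extensional V \<Longrightarrow> h x + k x = 1"
  shows "ennreal (1 - sqrt (real (card V)) * r / \<sigma>)
      \<le> (\<integral>\<^sup>+x. h x \<partial>PiM V (\<lambda>_. normal_law r \<sigma>)) + (\<integral>\<^sup>+x. k x \<partial>PiM V (\<lambda>_. normal_law (- r) \<sigma>))"
proof -
  interpret product_sigma_finite "\<lambda>_. lborel :: real measure"
    by (rule product_sigma_finite.intro) (rule sigma_finite_lborel)
  let ?N = "PiM V (\<lambda>_. lborel :: real measure)"
  define D where "D \<mu> x = (\<Prod>i\<in>V. normal_density \<mu> \<sigma> (x i))" for \<mu> and x :: "'u \<Rightarrow> real"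
  have D[measurable]: "D \<mu> \<in> borel_measurable ?N" for \<mu>
    unfolding D_def by measurable
  have D0: "0 \<le> D \<mu> x" for \<mu> x
    unfolding D_def by (intro prod_nonneg) auto
  have Density: "PiM V (\<lambda>_. normal_law \<mu> \<sigma>) = density ?N (D \<mu>)" for \<mu>
    unfolding normal_law_def D_def
    using V prob_space_normal_density[OF \<sigma>]
    by (subst PiM_density) (auto simp: prod_ennreal prob_space_imp_sigma_finite)
  have int: "(\<integral>\<^sup>+x. D \<mu> x \<partial>?N) = 1" for \<mu>
  proof -
    have 1: "(\<integral>\<^sup>+x. normal_density \<mu> \<sigma> x \<partial>lborel) = 1"
      using prob_space.emeasure_space_1[OF prob_space_normal_density[OF \<sigma>, of \<mu>]] by (simp add: emeasure_density)
    have "(\<integral>\<^sup>+x. D \<mu> x \<partial>?N) = (\<integral>\<^sup>+x. (\<Prod>i\<in>V. ennreal (normal_density \<mu> \<sigma> (x i))) \<partial>?N)"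
      by (simp add: D_def prod_ennreal)
    also have "\<dots> = 1"
      using V by (subst product_nn_integral_prod) (auto simp: 1)
    finally show ?thesis .
  qed
  define b where "b = exp (- r\<^sup>2 / (2 * \<sigma>\<^sup>2)) ^ card V"
  have b: "D r x * D (- r) x = (b * D 0 x)\<^sup>2" for x
    unfolding D_def b_def prod.distrib[symmetric] normal_density_mult_opposite
    by (simp add: prod_power_distrib power_mult_distrib prod.distrib power_mult[symmetric] mult.commute)
  have "b\<^sup>2 = exp (- (sqrt (real (card V)) * r / \<sigma>)\<^sup>2)"
    unfolding b_def by (simp add: power_mult_distrib power_divide flip: exp_of_nat_mult exp_double power_mult)
  then have "1 - (sqrt (real (card V)) * r / \<sigma>)\<^sup>2 \<le> b\<^sup>2"
    using exp_ge_add_one_self[of "- (sqrt (real (card V)) * r / \<sigma>)\<^sup>2"] by simp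
  moreover have "sets ?N = sets (PiM V (\<lambda>_. borel))"
    by (auto intro!: sets_PiM_cong)
  then have "h \<in> borel_measurable ?N" "k \<in> borel_measurable ?N"
    using meas by (simp_all cong: measurable_cong_sets)
  ultimately show ?thesis
    unfolding Density using \<sigma> r t hk
    by (intro testing_error_affinity[where m = "D 0" and b = b])
       (auto simp: D0 int b b_def space_PiM PiE_def)
qed

section \<open>From private mechanisms to tests\<close>

lemma output_law_in_prob_algebra:
  assumes M: "mechanism M" and U: "finite U" and P: "P \<in> space (prob_algebra borel)"
  shows "output_law M U P \<in> space (prob_algebra borel)"
    and "A \<in> sets borel \<Longrightarrow>
      emeasure (output_law M U P) A = (\<integral>\<^sup>+x. emeasure (M (with_values U x)) A \<partial>PiM U (\<lambda>_. P))"
proof -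
  have PU: "PiM U (\<lambda>_. P) \<in> space (prob_algebra (PiM U (\<lambda>_. borel)))"
    using P by (auto simp: space_prob_algebra intro!: sets_PiM_cong prob_space_PiM)
  have K: "(\<lambda>x. M (with_values U x)) \<in> PiM U (\<lambda>_. borel) \<rightarrow>\<^sub>M prob_algebra borel"
    using M U by (simp add: mechanism_def)
  show "output_law M U P \<in> space (prob_algebra borel)"
    using prob_space_bind'[OF PU K] sets_bind'[OF PU K] by (simp add: output_law_def space_prob_algebra)
  show "emeasure (output_law M U P) A = (\<integral>\<^sup>+x. emeasure (M (with_values U x)) A \<partial>PiM U (\<lambda>_. P))"
    if "A \<in> sets borel"
    using emeasure_bind_prob_algebra[OF PU K that] by (simp add: output_law_def)
qed

lemma normal_law_in_prob_algebra: "0 < \<sigma> \<Longrightarrow> normal_law \<mu> \<sigma> \<in> space (prob_algebra borel)"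
  by (simp add: space_prob_algebra normal_law_def prob_space_normal_density)

lemma neighbours_with_values_insert:
  assumes "finite S" "u \<notin> S"
  shows "neighbours u (with_values S x) (with_values (insert u S) (x(u := y)))"
proof -
  have "deletion u (with_values (insert u S) (x(u := y))) (with_values S x)"
    using assms(2) unfolding deletion_def with_values_def by force
  moreover have "with_values S x \<in> datasets" if "finite S" for S and x :: "'a \<Rightarrow> real"
    using that by (auto simp: datasets_def with_values_def inj_on_def)
  ultimately show ?thesis
    using assms(1) by (simp add: neighbours_def)
qed

text \<open>The privacy inequality is read from the smaller dataset to the larger one and divided by
  \<open>exp (\<E> u)\<close>, for \<open>A\<close> and for its complement. At extensional
  \<open>x\<close>, the points of the product space, measurability of the kernel also yields that
  the output laws are probability measures.\<close>

lemma pdp_dp_test: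
  assumes M: "pdp \<E> M" and T: "finite T" and A[measurable]: "A \<in> sets borel"
  shows "dp_test \<E> T (\<lambda>S x. emeasure (M (with_values S x)) A) (\<lambda>S x. emeasure (M (with_values S x)) (- A))"
proof -
  have K: "(\<lambda>x. M (with_values S x)) \<in> PiM S (\<lambda>_. borel) \<rightarrow>\<^sub>M prob_algebra borel" if "S \<subseteq> T" for S
    using M finite_subset[OF that T] by (simp add: pdp_def mechanism_def)
  have prob: "prob_space (M (with_values S x)) \<and> sets (M (with_values S x)) = sets borel"
    if "S \<subseteq> T" "x \<in> extensional S" for S x
    using measurable_space[OF K[OF that(1)], of x] that(2) by (simp add: space_prob_algebra space_PiM PiE_def)
  have mono: "ennreal (exp (- \<E> u)) * emeasure (M (with_values S x)) B
      \<le> emeasure (M (with_values (insert u S) (x(u := y)))) B"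
    if "S \<subseteq> T" "u \<in> T - S" "x \<in> extensional S" "B \<in> sets borel" for S u x y B
  proof -
    let ?D = "with_values S x" and ?D' = "with_values (insert u S) (x(u := y))"
    interpret D: prob_space "M ?D" using prob that by blast
    interpret D': prob_space "M ?D'"
      using prob[of "insert u S" "x(u := y)"] that by (auto simp: extensional_def)
    have "neighbours u ?D ?D'"
      using that T by (intro neighbours_with_values_insert) (auto dest: finite_subset)
    then have "measure (M ?D) B \<le> exp (\<E> u) * measure (M ?D') B"
      using M that(4) by (auto simp: pdp_def)
    then have "exp (- \<E> u) * measure (M ?D) B \<le> measure (M ?D') B"
      by (simp add: exp_minus field_simps)
    then show ?thesis
      by (simp add: D.emeasure_eq_measure D'.emeasure_eq_measure flip: ennreal_mult)
  qed
  show ?thesis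
    unfolding dp_test_def
  proof (intro conjI allI impI ballI)
    fix S assume S: "S \<subseteq> T"
    show "(\<lambda>x. emeasure (M (with_values S x)) A) \<in> borel_measurable (PiM S (\<lambda>_. borel))"
      "(\<lambda>x. emeasure (M (with_values S x)) (- A)) \<in> borel_measurable (PiM S (\<lambda>_. borel))"
      using measurable_compose[OF measurable_prob_algebraD[OF K[OF S]] measurable_emeasure_subprob_algebra]
      by auto
    fix x :: "'a \<Rightarrow> real" assume x: "x \<in> extensional S"
    interpret prob_space "M (with_values S x)" using prob S x by blast
    have sp: "sets (M (with_values S x)) = sets borel" using prob S x by blast
    have "emeasure (M (with_values S x)) A + emeasure (M (with_values S x)) (- A)
        = emeasure (M (with_values S x)) (A \<union> - A)"
      by (rule plus_emeasure) (auto simp: sp)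
    also have "A \<union> - A = space (M (with_values S x))"
      using sets_eq_imp_space_eq[OF sp] by auto
    finally show "emeasure (M (with_values S x)) A + emeasure (M (with_values S x)) (- A) = 1"
      by (simp add: emeasure_space_1)
  qed (auto intro!: mono)
qed

section \<open>Sorted budgets and the choice of constants\<close>

text \<open>The sorted list of budgets forgets who owns them. Sorting the users themselves by budget
  gives an aligned list, whose first \<open>k\<close> entries form \<open>W\<close>.\<close>

lemma sum_budgets_subset:
  assumes "finite U" "k \<le> card U"
  obtains W where "W \<subseteq> U" "card W = k" "(\<Sum>i = 1..k. budgets \<E> U ! (i - 1)) = sum \<E> W"
proof -
  obtain us where us: "set us = U" "distinct us"
    using finite_distinct_list[OF assms(1)] by blast
  define vs where "vs = sort_key \<E> us"
  have vs: "set vs = U" "distinct vs" "sorted (map \<E> vs)" "length vs = card U"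
    using us distinct_card by (force simp: vs_def)+
  have "mset_set U = mset vs"
    using vs mset_set_set by metis
  then have "budgets \<E> U = sort (map \<E> vs)"
    unfolding budgets_def by (simp flip: mset_map)
  then have bud: "budgets \<E> U = map \<E> vs"
    using vs sorted_sort_id by simp
  have "(\<Sum>i = 1..k. budgets \<E> U ! (i - 1)) = (\<Sum>i<k. budgets \<E> U ! i)"
    by (rule sum.reindex_bij_witness[of _ Suc "\<lambda>i. i - 1"]) auto
  also have "\<dots> = (\<Sum>i<k. \<E> (take k vs ! i))"
    using assms vs bud by (intro sum.cong) auto
  also have "\<dots> = sum_list (map \<E> (take k vs))"
    using assms vs by (simp add: sum_list_sum_nth atLeast0LessThan)
  also have "\<dots> = sum \<E> (set (take k vs))"
    using vs by (simp add: sum_list_distinct_conv_sum_set)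
  finally have "(\<Sum>i = 1..k. budgets \<E> U ! (i - 1)) = sum \<E> (set (take k vs))" .
  moreover have "card (set (take k vs)) = k"
    using assms vs by (simp add: distinct_card)
  moreover have "set (take k vs) \<subseteq> U"
    using vs set_take_subset by metis
  ultimately show thesis using that by blast
qed

text \<open>The denominator \<open>q\<close> is shared out as \<open>b = 2 * s / q\<close> for the
  revealed users and \<open>1 - b = S / q\<close> for the private ones. The two factors are at least
  \<open>exp (- b * ln 2)\<close> and \<open>exp (- (1 - b) * ln 2)\<close>, so their product is at
  least 1/2 for every \<open>b\<close>.\<close>

lemma error_constant:
  fixes S s \<sigma> r d :: real
  assumes S: "0 < S" and s: "0 \<le> s" and \<sigma>: "0 < \<sigma>" and r_eq: "r = 1 / sqrt 2 * (\<sigma> / (S + 2 * s))"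
    and d: "d \<le> 2 * r / (\<sigma> * sqrt (2 * pi))"
  shows "s * r / \<sigma> \<le> 1 / 2" and "1 / 2 \<le> exp (- (d * S)) * (1 - s * r / \<sigma>)"
proof -
  define q where "q = S + 2 * s"
  have q: "0 < q" and r: "r = \<sigma> / (sqrt 2 * q)" using S s by (simp_all add: q_def r_eq)
  define b where "b = 2 * s / q"
  have b: "0 \<le> b" "b \<le> 1" "1 - b = S / q"
    using S s q by (auto simp: b_def q_def field_simps)
  have "s * r / \<sigma> = b / (2 * sqrt 2)"
    using \<sigma> q by (simp add: r b_def field_simps)
  also have "\<dots> \<le> b / 2"
    using b by (intro divide_left_mono) auto
  finally have t: "s * r / \<sigma> \<le> b / 2" .
  then show "s * r / \<sigma> \<le> 1 / 2" using b by simp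
  \<comment> \<open>The numerical fact behind the constants is
    \<open>1 / sqrt pi \<le> ln 2\<close>. The number 2/3 separates the two sides, since
    \<open>pi \<ge> 9 / 4\<close>.\<close>
  have "3 / 2 \<le> sqrt pi"
    using pi_gt3 by (intro real_le_rsqrt) (simp add: power2_eq_square)
  then have "1 / sqrt pi \<le> 2 / 3"
    by (simp add: field_simps)
  also have "\<dots> \<le> ln 2" by (rule ln2_ge_two_thirds)
  finally have ln2: "1 / sqrt pi \<le> ln 2" .
  have "d * S \<le> 2 * r / (\<sigma> * sqrt (2 * pi)) * S"
    using d S by (intro mult_right_mono) auto
  also have "\<dots> = (1 - b) * (1 / sqrt pi)"
    unfolding b(3) using \<sigma> q by (simp add: r real_sqrt_mult field_simps)
  also have "\<dots> \<le> (1 - b) * ln 2"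
    using b ln2 by (intro mult_left_mono) auto
  finally have "exp (- ((1 - b) * ln 2)) \<le> exp (- (d * S))" by simp
  \<comment> \<open>The line \<open>1 - b / 2\<close> is the chord of the convex function
    \<open>exp (- b * ln 2)\<close> over the unit interval, hence lies above it.\<close>
  moreover have "exp (b * - ln 2) \<le> 1 - s * r / \<sigma>"
    using exp_mult_le_affine[OF b(1,2), of "- ln 2"] t by (simp add: exp_minus)
  ultimately have "exp (- ((1 - b) * ln 2)) * exp (b * - ln 2) \<le> exp (- (d * S)) * (1 - s * r / \<sigma>)"
    by (intro mult_mono) auto
  moreover have "- ((1 - b) * ln 2) + b * - ln 2 = - ln (2 :: real)"
    by (simp add: algebra_simps)
  then have "exp (- ((1 - b) * ln 2)) * exp (b * - ln 2) = (1 / 2 :: real)"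
    by (metis exp_add exp_ln exp_minus inverse_eq_divide zero_less_numeral)
  ultimately show "1 / 2 \<le> exp (- (d * S)) * (1 - s * r / \<sigma>)" by (simp only:)
qed


section \<open>The two-point argument for mechanisms\<close>

text \<open>Combines the recursion over \<open>W\<close> with the sample bound for the remaining
  users. The number \<open>d\<close> is the total variation distance between the laws of one value
  under the two means; it is hidden behind an upper bound because it has no elementary closed
  form.\<close>

lemma pdp_testing_error:
  fixes \<E> :: "'u \<Rightarrow> real" and \<sigma> r :: real
  assumes M: "pdp \<E> M" and \<sigma>: "0 < \<sigma>" and r: "0 \<le> r" and U: "finite U" and W: "W \<subseteq> U"
    and A: "A \<in> sets borel"
    and t: "sqrt (real (card (U - W))) * r / \<sigma> < 1"
  obtains d where "d \<le> 2 * r / (\<sigma> * sqrt (2 * pi))"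
    "exp (- (d * sum \<E> W)) * (1 - sqrt (real (card (U - W))) * r / \<sigma>)
      \<le> measure (output_law M U (normal_law r \<sigma>)) A + measure (output_law M U (normal_law (- r) \<sigma>)) (- A)"
proof -
  let ?p = "\<lambda>x. ennreal (normal_density r \<sigma> x)" and ?q = "\<lambda>x. ennreal (normal_density (- r) \<sigma> x)"
  let ?c = "\<lambda>x. ennreal (normal_density 0 \<sigma> (\<bar>x\<bar> + r))"
  let ?t = "sqrt (real (card (U - W))) * r / \<sigma>"
  have one: "(\<integral>\<^sup>+x. ennreal (normal_density \<mu> \<sigma> x) \<partial>lborel) = 1" for \<mu>
    using prob_space.emeasure_space_1[OF prob_space_normal_density[OF \<sigma>, of \<mu>]] by (simp add: emeasure_density)
  \<comment> \<open>By the triangle inequality the distance from \<open>x\<close> to either mean is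
    at most \<open>\<bar>x\<bar> + r\<close>, so \<open>?c\<close> lies below both
    densities.\<close>
  have le: "?c x \<le> ennreal (normal_density \<mu> \<sigma> x)" if "\<bar>\<mu>\<bar> = r" for \<mu> x
  proof -
    have "(x - \<mu>)\<^sup>2 \<le> (\<bar>x\<bar> + r - 0)\<^sup>2"
      using that by (intro power2_le_iff_abs_le[THEN iffD2]) auto
    then have "normal_density 0 \<sigma> (\<bar>x\<bar> + r) \<le> normal_density \<mu> \<sigma> x"
      using \<sigma> unfolding normal_density_def
      by (intro mult_left_mono) (auto simp: divide_right_mono)
    then show ?thesis by (rule ennreal_leI)
  qed
  have c_le: "(\<integral>\<^sup>+x. ?c x \<partial>lborel) \<le> 1"
    using nn_integral_mono[of lborel ?c ?p] le[of r] r one[of r] by simp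
  \<comment> \<open>The integral is at most 1, hence finite, so \<open>enn2real\<close> does not
    fall back to its default value 0.\<close>
  define d where "d = 1 - enn2real (\<integral>\<^sup>+x. ?c x \<partial>lborel)"
  have c: "(\<integral>\<^sup>+x. ?c x \<partial>lborel) = ennreal (1 - d)"
    using c_le by (auto simp: d_def ennreal_enn2real_if top_unique)
  have d: "0 \<le> d" "d \<le> 1"
    using c_le enn2real_mono[of _ 1] by (auto simp: d_def)
  have "1 \<le> ennreal (1 - d + 2 * r / (\<sigma> * sqrt (2 * pi)))"
    using normal_density_overlap[OF \<sigma> r] d \<sigma> r unfolding c by (subst ennreal_plus) auto
  then have d_le: "d \<le> 2 * r / (\<sigma> * sqrt (2 * pi))"
    by (simp flip: ennreal_1 add: ennreal_le_iff2)
  let ?f = "\<lambda>S x. emeasure (M (with_values S x)) A" and ?g = "\<lambda>S x. emeasure (M (with_values S x)) (- A)"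
  have WV: "W \<union> (U - W) = U" using W by auto
  have fin: "finite W" "finite (U - W)" using U W by (auto dest: finite_subset)
  have base: "ennreal (1 - ?t)
      \<le> (\<integral>\<^sup>+x. f (U - W) x \<partial>PiM (U - W) (\<lambda>_. density lborel ?p))
        + (\<integral>\<^sup>+x. g (U - W) x \<partial>PiM (U - W) (\<lambda>_. density lborel ?q))"
    if "dp_test \<E> (U - W) f g" for f g
    unfolding normal_law_def[symmetric]
    using that by (intro normal_sample_testing_error[OF \<sigma> r fin(2) t]) (simp_all add: dp_test_def)
  have "exp (- (d * sum \<E> W)) = (\<Prod>u\<in>W. exp (d * - \<E> u))"
    using fin by (simp add: exp_sum sum_distrib_left flip: sum_negf)
  also have "\<dots> \<le> (\<Prod>u\<in>W. 1 - d + d * exp (- \<E> u))"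
    by (intro prod_mono conjI exp_mult_le_affine d) auto
  finally have "ennreal (exp (- (d * sum \<E> W)) * (1 - ?t))
      \<le> (\<Prod>u\<in>W. ennreal (1 - d + d * exp (- \<E> u))) * ennreal (1 - ?t)"
    using t d by (subst prod_ennreal) (auto simp: ennreal_mult' intro!: mult_right_mono ennreal_leI)
  also have "\<dots> \<le> (\<integral>\<^sup>+x. ?f (W \<union> (U - W)) x \<partial>PiM (W \<union> (U - W)) (\<lambda>_. density lborel ?p))
        + (\<integral>\<^sup>+x. ?g (W \<union> (U - W)) x \<partial>PiM (W \<union> (U - W)) (\<lambda>_. density lborel ?q))"
    using r by (intro dp_test_lower_bound[where c = ?c and d = d] le one c d fin base pdp_dp_test M A) (auto simp: U fin)
  also have "\<dots> = emeasure (output_law M U (normal_law r \<sigma>)) A + emeasure (output_law M U (normal_law (- r) \<sigma>)) (- A)"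
    unfolding WV using M U A \<sigma>
    by (simp add: output_law_in_prob_algebra(2)[OF _ _ normal_law_in_prob_algebra] pdp_def flip: normal_law_def)
  also have "\<dots> = ennreal (measure (output_law M U (normal_law r \<sigma>)) A + measure (output_law M U (normal_law (- r) \<sigma>)) (- A))"
  proof -
    have "prob_space (output_law M U (normal_law \<mu> \<sigma>))" for \<mu>
      using output_law_in_prob_algebra(1)[OF _ U normal_law_in_prob_algebra[OF \<sigma>]] M
      by (simp add: pdp_def space_prob_algebra)
    then have "finite_measure (output_law M U (normal_law \<mu> \<sigma>))" for \<mu>
      by (simp add: prob_space_def)
    then show ?thesis
      by (simp add: finite_measure.emeasure_eq_measure)
  qed
  finally have "exp (- (d * sum \<E> W)) * (1 - ?t)
      \<le> measure (output_law M U (normal_law r \<sigma>)) A + measure (output_law M U (normal_law (- r) \<sigma>)) (- A)"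
    by (subst (asm) ennreal_le_iff) auto
  with d_le show thesis by (rule that)
qed

theorem theorem8:
  fixes \<E> :: "'u \<Rightarrow> real" and U :: "'u set" and n :: nat
    and \<sigma> \<epsilon>_min \<epsilon>_max :: real
  assumes "\<sigma> > 0"
    and "\<epsilon>_min > 0"
    and "\<And>u. \<E> u \<in> {\<epsilon>_min..\<epsilon>_max}"
    and "finite U" and "card U = n" and "n \<ge> 1"
  shows "(INF M \<in> {M. pdp \<E> M}. SUP \<mu> \<in> (UNIV :: real set).
            measure (output_law M U (normal_law \<mu> \<sigma>))
              {y. \<bar>y - \<mu>\<bar> \<ge> error_bound \<sigma> \<E> U}) \<ge> 1 / 4"
proof (rule cINF_greatest)
  \<comment> \<open>An infimum of reals is meaningful only over a nonempty set. The constant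
    mechanism is a witness: it is private because \<open>exp (\<E> u) \<ge> 1\<close>.\<close>
  have "prob_space (return borel (0 :: real))"
    by (rule prob_space_return) simp
  then have "pdp \<E> (\<lambda>_. return borel 0)"
    unfolding pdp_def mechanism_def
  proof (intro conjI allI impI ballI)
    fix u and D D' :: "'u dataset" and K :: "real set"
    have "0 \<le> \<E> u" using assms(2) assms(3)[of u] by simp
    then show "measure (return borel 0) K \<le> exp (\<E> u) * measure (return borel 0) K"
      by (simp add: mult_le_cancel_right1)
  qed (auto simp: space_prob_algebra)
  then show "{M. pdp \<E> M} \<noteq> {}" by blast
next
  fix M assume "M \<in> {M. pdp \<E> M}"
  then have M: "pdp \<E> M" by simp
  define r where "r = error_bound \<sigma> \<E> U"
  let ?err = "\<lambda>k. 1 / sqrt 2 * (\<sigma> / ((\<Sum>i = 1..k. budgets \<E> U ! (i - 1)) + 2 * sqrt (real (n - k))))"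
  have "r = Max (?err ` {1..n})"
    by (simp add: r_def error_bound_def Let_def assms(5))
  moreover have "Max (?err ` {1..n}) \<in> ?err ` {1..n}"
    using assms(6) by (intro Max_in) auto
  ultimately obtain k where k: "1 \<le> k" "k \<le> n" "r = ?err k" by auto
  obtain W where W: "W \<subseteq> U" "card W = k" "(\<Sum>i = 1..k. budgets \<E> U ! (i - 1)) = sum \<E> W"
    using sum_budgets_subset[OF assms(4), of k \<E>] k assms(5) by auto
  have card: "card (U - W) = n - k"
    using W assms(4,5) by (metis card_Diff_subset finite_subset)
  have "0 < \<E> u" for u
    using assms(2) assms(3)[of u] by simp
  \<comment> \<open>As \<open>k \<ge> 1\<close>, the set \<open>W\<close> is nonempty. This keeps
    the denominator positive even for \<open>k = n\<close>, where the square root vanishes.\<close>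
  then have S: "0 < sum \<E> W"
    using W k assms(4) by (intro sum_pos) (auto dest: finite_subset)
  have r: "r = 1 / sqrt 2 * (\<sigma> / (sum \<E> W + 2 * sqrt (real (card (U - W)))))"
    using k W card by simp
  have r0: "0 < r"
    unfolding r using S assms(1) by (simp add: add_pos_nonneg)
  let ?A = "{y. r \<le> \<bar>y - r\<bar>}"
  have t: "sqrt (real (card (U - W))) * r / \<sigma> \<le> 1 / 2"
    using error_constant(1)[OF S _ assms(1) r order_refl] by simp
  have A: "?A \<in> sets borel" by measurable
  have t1: "sqrt (real (card (U - W))) * r / \<sigma> < 1" using t by linarith
  obtain d where d: "d \<le> 2 * r / (\<sigma> * sqrt (2 * pi))"
      "exp (- (d * sum \<E> W)) * (1 - sqrt (real (card (U - W))) * r / \<sigma>)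
        \<le> measure (output_law M U (normal_law r \<sigma>)) ?A + measure (output_law M U (normal_law (- r) \<sigma>)) (- ?A)"
    by (rule pdp_testing_error[OF M assms(1) less_imp_le[OF r0] assms(4) W(1) A t1])
  let ?R = "\<lambda>\<mu>. measure (output_law M U (normal_law \<mu> \<sigma>)) {y. r \<le> \<bar>y - \<mu>\<bar>}"
  have prob: "prob_space (output_law M U (normal_law \<mu> \<sigma>))"
    and sets: "sets (output_law M U (normal_law \<mu> \<sigma>)) = sets borel" for \<mu>
    using output_law_in_prob_algebra(1)[OF _ assms(4) normal_law_in_prob_algebra[OF assms(1)]] M
    by (simp_all add: pdp_def space_prob_algebra)
  have "1 / 2 \<le> ?R r + measure (output_law M U (normal_law (- r) \<sigma>)) (- ?A)"
    using error_constant(2)[OF S _ assms(1) r d(1)] d(2) by (meson order_trans real_sqrt_ge_zero of_nat_0_le_iff)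
  \<comment> \<open>An output closer than \<open>r\<close> to the mean \<open>r\<close> is positive,
    hence farther than \<open>r\<close> from \<open>- r\<close>: success under one mean is failure
    under the other.\<close>
  also have "measure (output_law M U (normal_law (- r) \<sigma>)) (- ?A) \<le> ?R (- r)"
  proof (rule finite_measure.finite_measure_mono)
    show "finite_measure (output_law M U (normal_law (- r) \<sigma>))"
      using prob by (simp add: prob_space_def)
    show "- ?A \<subseteq> {y. r \<le> \<bar>y - - r\<bar>}" by auto
  qed (simp add: sets)
  finally have "1 / 2 \<le> ?R r + ?R (- r)" by simp
  \<comment> \<open>A supremum of reals dominates the members of a bounded family; here the members
    are probabilities.\<close>
  moreover have "bdd_above (range ?R)"
    using prob_space.prob_le_1[OF prob] by (intro bdd_aboveI2)
  then have "?R \<mu> \<le> (SUP \<mu>. ?R \<mu>)" for \<mu>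
    by (rule cSUP_upper2) auto
  from this[of r] this[of "- r"] have "?R r + ?R (- r) \<le> 2 * (SUP \<mu>. ?R \<mu>)" by simp
  ultimately show "1 / 4 \<le> (SUP \<mu> \<in> UNIV. measure (output_law M U (normal_law \<mu> \<sigma>))
      {y. \<bar>y - \<mu>\<bar> \<ge> error_bound \<sigma> \<E> U})"
    unfolding r_def[symmetric] by simp
qed

end
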